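(* Let $q\in(1,M+1]$. The following statements are equivalent: (i) $q\notin\overline{\mathcal U}$; (ii) $\mathcal U_q'$ is a shift of finite type; (iii) $\mathcal U_q'$ is a shift; (iv) $\mathcal U_q'$ is a closed subset of $A^{\mathbb N}$.
   Context: Fix a positive integer $M$ and $A=\{0,1,\dots,M\}$; $A^{\mathbb N}$ carries the product of discrete topologies (coordinatewise convergence). For $q\in(1,M+1]$ an expansion of $x$ in base $q$ is $(c_i)\in A^{\mathbb N}$ with $\sum_{i\ge1}c_iq^{-i}=x$; $J_q=[0,M/(q-1)]$. $\mathcal U$ is the set of $q>1$ such that $1$ has a unique expansion in base $q$, $\overline{\mathcal U}$ its closure. $\mathcal U_q'$ is the set of sequences that are the unique expansion in base $q$ of some $x\in J_q$. A set $S\subseteq A^{\mathbb N}$ is a shift if there is a set $\mathcal F\subseteq\bigcup_{k\ge1}A^k$ of words such that $(c_i)\in S$ iff no block $c_{i+1}\cdots c_{i+n}$ ($i\ge0$, $n\ge1$) belongs to $\mathcal F$; it is a shift of finite type if $\mathcal F$ can be chosen finite. *)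

theory Defs
  imports "HOL-Analysis.Analysis"
begin

definition digits :: "nat \<Rightarrow> nat set" where
  "digits M = {0..M}"

text \<open>Sequences are indexed from 0: the term \<open>c i\<close> is the digit $c_{i+1}$.\<close>

definition seqs :: "nat \<Rightarrow> (nat \<Rightarrow> nat) set" where
  "seqs M = {c. \<forall>i. c i \<in> digits M}"

definition seq_topology :: "nat \<Rightarrow> (nat \<Rightarrow> nat) topology" where
  "seq_topology M = product_topology (\<lambda>_. discrete_topology (digits M)) UNIV"

lemma topspace_seq_topology: "topspace (seq_topology M) = seqs M"
  by (auto simp: seq_topology_def seqs_def PiE_def Pi_def)

definition is_expansion :: "nat \<Rightarrow> real \<Rightarrow> (nat \<Rightarrow> nat) \<Rightarrow> real \<Rightarrow> bool" where
  "is_expansion M q c x \<longleftrightarrow> c \<in> seqs M \<and> (\<lambda>i. real (c i) / q ^ (i + 1)) sums x"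

definition J :: "nat \<Rightarrow> real \<Rightarrow> real set" where
  "J M q = {0..real M / (q - 1)}"

text \<open>No upper bound on the base is needed: for $q > M + 1$ the number 1 has no expansion.\<close>

definition univoque_bases :: "nat \<Rightarrow> real set" where
  "univoque_bases M = {q. q > 1 \<and> (\<exists>!c. is_expansion M q c 1)}"

definition unique_expansions :: "nat \<Rightarrow> real \<Rightarrow> (nat \<Rightarrow> nat) set" where
  "unique_expansions M q =
     {c. \<exists>x\<in>J M q. is_expansion M q c x \<and> (\<forall>d. is_expansion M q d x \<longrightarrow> d = c)}"

definition nonempty_words :: "nat \<Rightarrow> nat list set" where
  "nonempty_words M = {w. w \<noteq> [] \<and> set w \<subseteq> digits M}"

definition shift_of :: "nat \<Rightarrow> nat list set \<Rightarrow> (nat \<Rightarrow> nat) set" where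
  "shift_of M F = {c \<in> seqs M. \<forall>i. \<forall>n\<ge>1. map c [i..<i + n] \<notin> F}"

definition is_shift :: "nat \<Rightarrow> (nat \<Rightarrow> nat) set \<Rightarrow> bool" where
  "is_shift M S \<longleftrightarrow> (\<exists>F \<subseteq> nonempty_words M. S = shift_of M F)"

definition is_shift_of_finite_type :: "nat \<Rightarrow> (nat \<Rightarrow> nat) set \<Rightarrow> bool" where
  "is_shift_of_finite_type M S \<longleftrightarrow> (\<exists>F \<subseteq> nonempty_words M. finite F \<and> S = shift_of M F)"

end

theory Submission
  imports Defs
begin

text \<open>Let \<open>\<alpha>\<close> be the quasi-greedy expansion of 1 in base \<open>q\<close>. A sequence is a unique expansion iff
  every tail following a digit below \<open>M\<close>, and the reflection (digitwise \<open>M - c\<close>) of every tail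
  following a nonzero digit, is lexicographically smaller than \<open>\<alpha>\<close>. Everything hinges on the
  condition that the reflections of all proper tails of \<open>\<alpha>\<close> are smaller than \<open>\<alpha>\<close>.

  If it fails at the \<open>k\<close>-th tail, comparing \<open>k\<close> digits already decides the inequalities above, so
  the unique expansions form a shift of finite type. If it holds, there are arbitrarily long
  prefixes \<open>w\<close> of \<open>\<alpha>\<close> none of whose suffixes is the reflection of a prefix. Writing \<open>w'\<close> for the
  reflection of \<open>w\<close>, the sequences \<open>0(ww')(ww')\<dots>\<close> are unique expansions converging to
  \<open>0\<alpha>\<close>, which is not one.

  The condition is equivalent to \<open>q\<close> lying in the closure of the univoque bases. If it holds and
  \<open>\<alpha>\<close> is aperiodic, then \<open>q\<close> is univoque. If \<open>\<alpha>\<close> is periodic, a long prefix of \<open>\<alpha>\<close> followed by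
  \<open>w'ww'w\<dots>\<close> is the unique expansion of 1 in some base near \<open>q\<close>. Conversely, the quasi-greedy
  expansions \<open>\<gamma>\<close> in univoque bases tending to \<open>q\<close> converge to \<open>\<alpha>\<close>, and each of the cases
  \<open>\<gamma> < \<alpha>\<close>, \<open>\<gamma> = \<alpha>\<close>, \<open>\<gamma> > \<alpha>\<close> contradicts a failure of the condition.\<close>

section \<open>Lexicographic order, tails and reflections\<close>

definition tail :: "nat \<Rightarrow> (nat \<Rightarrow> nat) \<Rightarrow> nat \<Rightarrow> nat" where
  "tail n c = (\<lambda>i. c (n + i))"

definition mirror :: "nat \<Rightarrow> (nat \<Rightarrow> nat) \<Rightarrow> nat \<Rightarrow> nat" where
  "mirror M c = (\<lambda>i. M - c i)"

text \<open>Such a comparison involves only the first \<open>n\<close> digits, so it carries over to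
  all sequences sharing these digits.\<close>

definition lex_less_upto :: "nat \<Rightarrow> (nat \<Rightarrow> nat) \<Rightarrow> (nat \<Rightarrow> nat) \<Rightarrow> bool" where
  "lex_less_upto n c d \<longleftrightarrow> (\<exists>i<n. (\<forall>l<i. c l = d l) \<and> c i < d i)"

definition lex_less :: "(nat \<Rightarrow> nat) \<Rightarrow> (nat \<Rightarrow> nat) \<Rightarrow> bool" where
  "lex_less c d \<longleftrightarrow> (\<exists>i. (\<forall>l<i. c l = d l) \<and> c i < d i)"

lemma seqs_iff: "c \<in> seqs M \<longleftrightarrow> (\<forall>i. c i \<le> M)"
  by (simp add: seqs_def digits_def)

lemma tail_in_seqs [simp]: "c \<in> seqs M \<Longrightarrow> tail n c \<in> seqs M"
  by (simp add: seqs_iff tail_def)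

lemma mirror_in_seqs [simp]: "mirror M c \<in> seqs M"
  by (simp add: seqs_iff mirror_def)

lemma tail_0 [simp]: "tail 0 c = c"
  by (simp add: tail_def)

lemma tail_tail [simp]: "tail m (tail n c) = tail (n + m) c"
  by (simp add: tail_def add.assoc)

lemma tail_mirror: "tail n (mirror M c) = mirror M (tail n c)"
  by (simp add: tail_def mirror_def)

lemma mirror_mirror [simp]: "c \<in> seqs M \<Longrightarrow> mirror M (mirror M c) = c"
  by (auto simp: mirror_def seqs_iff)

lemma lex_less_uptoI:
  "i < n \<Longrightarrow> (\<And>l. l < i \<Longrightarrow> c l = d l) \<Longrightarrow> c i < d i \<Longrightarrow> lex_less_upto n c d"
  by (auto simp: lex_less_upto_def)

lemma lex_lessI: "(\<And>l. l < i \<Longrightarrow> c l = d l) \<Longrightarrow> c i < d i \<Longrightarrow> lex_less c d"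
  by (auto simp: lex_less_def)

lemma lex_less_upto_mono: "lex_less_upto m c d \<Longrightarrow> m \<le> n \<Longrightarrow> lex_less_upto n c d"
  by (auto simp: lex_less_upto_def intro: less_le_trans)

lemma lex_less_iff_upto: "lex_less c d \<longleftrightarrow> (\<exists>n. lex_less_upto n c d)"
  by (auto simp: lex_less_upto_def lex_less_def)

lemma lex_less_upto_cong:
  assumes "lex_less_upto n c d" "\<And>i. i < n \<Longrightarrow> c' i = c i" "\<And>i. i < n \<Longrightarrow> d' i = d i"
  shows "lex_less_upto n c' d'"
proof -
  obtain i where "i < n" "\<forall>l<i. c l = d l" "c i < d i"
    using assms(1) by (auto simp: lex_less_upto_def)
  then show ?thesis using assms(2,3) by (intro lex_less_uptoI[of i]) auto
qed

lemma lex_less_irrefl [simp]: "\<not> lex_less c c"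
  by (simp add: lex_less_def)

lemma lex_less_linear: "lex_less c d \<or> c = d \<or> lex_less d c"
proof (cases "c = d")
  case False
  define i where "i = (LEAST i. c i \<noteq> d i)"
  from False have "\<exists>i. c i \<noteq> d i" by auto
  then have "c i \<noteq> d i" unfolding i_def by (rule LeastI_ex)
  moreover have "c l = d l" if "l < i" for l
    using not_less_Least[of l "\<lambda>i. c i \<noteq> d i"] that unfolding i_def by auto
  ultimately show ?thesis
    by (metis lex_less_def linorder_neq_iff)
qed auto

lemma lex_less_trans:
  assumes "lex_less b c" "lex_less c d"
  shows "lex_less b d"
proof -
  obtain i j where "\<forall>l<i. b l = c l" "b i < c i" "\<forall>l<j. c l = d l" "c j < d j"
    using assms by (auto simp: lex_less_def)
  note ij = this
  show ?thesis
  proof (rule lex_lessI[of "min i j"])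
    show "b l = d l" if "l < min i j" for l using ij that by simp
    show "b (min i j) < d (min i j)"
      using ij by (cases i j rule: linorder_cases) auto
  qed
qed

lemma lex_less_asym: "lex_less c d \<Longrightarrow> \<not> lex_less d c"
  using lex_less_trans lex_less_irrefl by blast

lemma lex_less_mirror:
  assumes "c \<in> seqs M" "d \<in> seqs M"
  shows "lex_less (mirror M c) (mirror M d) \<longleftrightarrow> lex_less d c"
proof -
  have le: "c i \<le> M" "d i \<le> M" for i using assms by (auto simp: seqs_iff)
  have "M - c i = M - d i \<longleftrightarrow> d i = c i" "M - c i < M - d i \<longleftrightarrow> d i < c i" for i
    using le[of i] by auto
  then show ?thesis by (simp add: lex_less_def mirror_def)
qed

lemma lex_less_mirror_left:
  "c \<in> seqs M \<Longrightarrow> d \<in> seqs M \<Longrightarrow> lex_less (mirror M c) d \<longleftrightarrow> lex_less (mirror M d) c"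
  using lex_less_mirror[of c M "mirror M d"] by simp

lemma lex_less_tail:
  assumes "\<And>i. i < k \<Longrightarrow> c i = d i"
  shows "lex_less (tail k c) (tail k d) \<longleftrightarrow> lex_less c d"
proof
  assume "lex_less (tail k c) (tail k d)"
  then obtain i where i: "\<forall>l<i. c (k + l) = d (k + l)" "c (k + i) < d (k + i)"
    by (auto simp: lex_less_def tail_def)
  show "lex_less c d"
  proof (rule lex_lessI[of "k + i"])
    fix l assume "l < k + i"
    then show "c l = d l"
      using assms[of l] i(1)[rule_format, of "l - k"] by (cases "l < k") auto
  qed (use i in auto)
next
  assume "lex_less c d"
  then obtain i where i: "\<forall>l<i. c l = d l" "c i < d i" by (auto simp: lex_less_def)
  with assms have "k \<le> i" by (metis less_irrefl not_le)
  with i show "lex_less (tail k c) (tail k d)"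
    by (intro lex_lessI[of "i - k"]) (auto simp: tail_def)
qed

lemma not_lex_less_cases:
  assumes "\<not> lex_less d c"
  shows "lex_less_upto n c d \<or> (\<forall>i<n. c i = d i)"
proof -
  consider "c = d" | "lex_less c d" using assms lex_less_linear by blast
  then show ?thesis
  proof cases
    case 2
    then obtain i where "\<forall>l<i. c l = d l" "c i < d i" by (auto simp: lex_less_def)
    then show ?thesis
      by (cases "i < n") (auto intro: lex_less_uptoI[of i])
  qed auto
qed

lemma periodic_tail: "tail n c = c \<Longrightarrow> tail s c = tail (s mod n) c"
proof (induction s rule: less_induct)
  case (less s)
  show ?case
  proof (cases "n > 0 \<and> n \<le> s")
    case True
    then have "tail s c = tail (s - n) (tail n c)" by simp
    with less True show ?thesis by (simp add: le_mod_geq)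
  qed auto
qed

text \<open>A periodic sequence has only finitely many tails, so the largest of the bounds over one
  period serves for all of them.\<close>

lemma periodic_uniform_bound:
  assumes "tail n c = c" "n \<ge> 1"
    and ex: "\<And>s. \<exists>T. R T (tail s c)"
    and mono: "\<And>T T' y. R T y \<Longrightarrow> T \<le> T' \<Longrightarrow> R T' y"
  shows "\<exists>T::nat. \<forall>s. R T (tail s c)"
proof -
  obtain f where f: "R (f s) (tail s c)" for s using ex by metis
  have "R (Max (f ` {..<n})) (tail s c)" for s
  proof -
    have "R (Max (f ` {..<n})) (tail (s mod n) c)"
      using assms(2) by (intro mono[OF f]) auto
    then show ?thesis using periodic_tail[OF assms(1), of s] by simp
  qed
  then show ?thesis by blast
qed

section \<open>Sequences exceeding the reflections of their tails\<close>

text \<open>For a digit sequence of value 1 in some base, this suffices to be the unique expansion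
  of 1 there. Strictness for the tails themselves rules out periodic sequences.\<close>

definition strongly_dominant :: "nat \<Rightarrow> (nat \<Rightarrow> nat) \<Rightarrow> bool" where
  "strongly_dominant M e \<longleftrightarrow>
     (\<forall>j\<ge>1. lex_less (tail j e) e \<and> lex_less (mirror M (tail j e)) e)"

locale dominant =
  fixes M :: nat and a :: "nat \<Rightarrow> nat"
  assumes in_seqs: "a \<in> seqs M"
    and tail_le: "\<not> lex_less a (tail k a)"
    and mirror_tail_less: "k \<ge> 1 \<Longrightarrow> lex_less (mirror M (tail k a)) a"
begin

lemma digit_le: "a i \<le> M"
  using in_seqs by (simp add: seqs_iff)

lemma digit_le_first: "a i \<le> a 0"
  using tail_le[of i] by (force simp: lex_less_def tail_def)

lemma mirror_digit_le_first: "k \<ge> 1 \<Longrightarrow> M - a k \<le> a 0"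
  using mirror_tail_less[of k] unfolding lex_less_def mirror_def tail_def
  by (metis add_0_right le_eq_less_or_eq less_nat_zero_code linorder_cases)

text \<open>Otherwise the bounds on digits and reflected digits by \<open>a 0\<close> force
  \<open>a\<close> to be constant with \<open>M = 2 * a 0\<close>, and then \<open>a\<close> equals
  the reflection of its own tail.\<close>

lemma mirror_first_less: "M - a 0 < a 0"
proof (rule ccontr)
  assume "\<not> M - a 0 < a 0"
  then have "a k = a 0 \<and> M - a k = a 0" if "k \<ge> 1" for k
    using mirror_digit_le_first[OF that] digit_le_first[of k] digit_le[of k] digit_le[of 0]
    by linarith
  then have "mirror M (tail 1 a) = a"
    by (auto simp: mirror_def tail_def fun_eq_iff) (metis neq0_conv less_eq_Suc_le One_nat_def)
  then show False using mirror_tail_less[of 1] by simp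
qed

lemma mirror_tail_less': "lex_less (mirror M (tail k a)) a"
proof (cases "k = 0")
  case True
  then show ?thesis
    using mirror_first_less by (auto intro!: lex_lessI[of 0] simp: mirror_def)
qed (use mirror_tail_less in simp)

text \<open>A prefix length is good if no suffix of that prefix is the reflection of a prefix.\<close>

definition good :: "nat \<Rightarrow> bool" where
  "good m \<longleftrightarrow> (\<forall>k<m. lex_less_upto (m - k) (mirror M (tail k a)) a)"

definition mirrored :: "nat \<Rightarrow> nat \<Rightarrow> bool" where
  "mirrored m k \<longleftrightarrow> k < m \<and> (\<forall>l<m-k. M - a (k + l) = a l)"

lemma not_mirrored:
  assumes "k < m" "\<not> mirrored m k"
  shows "lex_less_upto (m - k) (mirror M (tail k a)) a"
  using not_lex_less_cases[OF lex_less_asym[OF mirror_tail_less'[of k]], of "m - k"] assms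
  by (auto simp: mirrored_def mirror_def tail_def)

text \<open>If some \<open>i < k\<close> were mirrored in the prefix of length \<open>k\<close>, two
  reflections would overlap. Minimality of \<open>k\<close> puts the first disagreement of the
  reflection at \<open>i\<close> beyond position \<open>k\<close>; composing with the reflection at
  \<open>k\<close> makes the tail at \<open>k - i\<close> larger than \<open>a\<close>.\<close>

lemma good_if_least_mirrored:
  assumes m: "mirrored m k" and least: "\<And>i. i < k \<Longrightarrow> \<not> mirrored m i"
  shows "good k"
proof (rule ccontr)
  assume "\<not> good k"
  then obtain i where i: "mirrored k i" using not_mirrored by (auto simp: good_def)
  then have ik: "i < k" by (simp add: mirrored_def)
  have km: "k < m" using m by (simp add: mirrored_def)
  have "lex_less_upto (m - i) (mirror M (tail i a)) a"
    using not_mirrored[of i m] least[OF ik] ik km by simp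
  then obtain t where t: "t < m - i" "\<forall>l<t. M - a (i + l) = a l" "M - a (i + t) < a t"
    by (auto simp: lex_less_upto_def mirror_def tail_def)
  have "t \<ge> k - i"
    using i t(3) by (metis mirrored_def not_le less_irrefl)
  then obtain s where s: "t = (k - i) + s" using le_Suc_ex by blast
  have e1: "M - a (k + l) = a l" if "l < m - k" for l
    using m that by (simp add: mirrored_def)
  have "s < m - k" using s t(1) ik km by simp
  have e2: "M - a (k + l) = a (k - i + l)" if "l < s" for l
    using t(2)[rule_format, of "k - i + l"] s ik that by simp
  have "lex_less a (tail (k - i) a)"
  proof (rule lex_lessI[of s])
    fix l assume "l < s"
    then show "a l = tail (k - i) a l"
      using e1[of l] e2[of l] \<open>s < m - k\<close> by (simp add: tail_def)
  next
    show "a s < tail (k - i) a s"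
      using e1[of s] t(3) s \<open>s < m - k\<close> ik by (simp add: tail_def)
  qed
  then show False using tail_le by blast
qed

text \<open>For \<open>m\<close> so long that the first \<open>N + 1\<close> reflected tails are all
  decided inside the prefix, no \<open>k\<close> up to \<open>N\<close> is mirrored. Hence
  \<open>m\<close> is good or the least mirrored \<open>k\<close> is a good length above
  \<open>N\<close>.\<close>

lemma good_unbounded: "\<exists>m>N. good m"
proof (rule ccontr)
  assume none: "\<not> (\<exists>m>N. good m)"
  obtain f where f: "mirror M (tail k a) (f k) < a (f k)" for k
    using mirror_tail_less' unfolding lex_less_def by metis
  define m where "m = Suc N + Max ((\<lambda>k. k + f k) ` {..N})"
  have fm: "k + f k < m" if "k \<le> N" for k
  proof -
    have "k + f k \<le> Max ((\<lambda>k. k + f k) ` {..N})" using that by (intro Max_ge) auto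
    then show ?thesis by (simp add: m_def)
  qed
  have "\<not> good m" using none by (auto simp: m_def)
  then have ex: "\<exists>k. mirrored m k" using not_mirrored by (auto simp: good_def)
  define k where "k = (LEAST k. mirrored m k)"
  have k: "mirrored m k" unfolding k_def using ex by (rule LeastI_ex)
  have "good k"
    using k by (rule good_if_least_mirrored) (use not_less_Least k_def in blast)
  then have "k \<le> N" using none not_le by blast
  then have "f k < m - k" using fm[of k] by simp
  then have "M - a (k + f k) = a (f k)" using k by (simp add: mirrored_def)
  then show False using f[of k] by (simp add: mirror_def tail_def)
qed

section \<open>Periodic sequences built from a prefix and its reflection\<close>

definition alternating :: "nat \<Rightarrow> nat \<Rightarrow> nat" where
  "alternating m i = (if even (i div m) then a (i mod m) else M - a (i mod m))"

lemma alternating_in_seqs: "alternating m \<in> seqs M"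
  using digit_le by (simp add: seqs_iff alternating_def)

lemma alternating_prefix: "i < m \<Longrightarrow> alternating m i = a i"
  by (simp add: alternating_def)

lemma tail_alternating:
  assumes "m \<ge> 1"
  shows "tail m (alternating m) = mirror M (alternating m)"
  using assms digit_le by (auto simp: tail_def mirror_def alternating_def fun_eq_iff)

lemma tail_alternating_period:
  assumes "m \<ge> 1"
  shows "tail (m + m) (alternating m) = alternating m"
  using tail_tail[of m m "alternating m"] tail_alternating[OF assms]
  by (simp add: tail_mirror alternating_in_seqs)

text \<open>Shifting by \<open>m\<close> reflects the sequence and so exchanges the two claims,
  which reduces everything to \<open>j < m\<close>. There goodness decides the reflected tail, and
  also the tail itself once it has run through the prefix.\<close>

lemma alternating_tails_less:
  assumes "m \<ge> 1" "good m"
  shows "lex_less (tail j (alternating m)) a \<and> lex_less (mirror M (tail j (alternating m))) a"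
proof (induction j rule: less_induct)
  case (less j)
  define d where "d = alternating m"
  have d: "d \<in> seqs M" "\<And>i. i < m \<Longrightarrow> d i = a i" "tail m d = mirror M d"
    using alternating_in_seqs alternating_prefix tail_alternating[OF assms(1)]
    by (auto simp: d_def)
  consider "j \<ge> m" | "j = 0" | "0 < j" "j < m" by linarith
  then show ?case unfolding d_def[symmetric]
  proof cases
    case 1
    then have "tail j d = mirror M (tail (j - m) d)"
      using tail_tail[of "j - m" m d] by (simp add: d(3) tail_mirror)
    then show "lex_less (tail j d) a \<and> lex_less (mirror M (tail j d)) a"
      using less[of "j - m"] 1 assms(1) by (simp add: d_def alternating_in_seqs)
  next
    case 2
    have "lex_less d a"
    proof (rule ccontr)
      assume nl: "\<not> lex_less d a"
      \<comment> \<open>If \<open>d\<close> were at least \<open>a\<close>, then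
        \<open>tail m d = mirror M d\<close> would be at most \<open>mirror M a\<close>, hence below
        \<open>tail m a\<close>. As \<open>d\<close> and \<open>a\<close> share \<open>m\<close>
        digits, this already gives \<open>d\<close> below \<open>a\<close>.\<close>
      have "lex_less (mirror M a) (tail m a)"
        using mirror_tail_less'[of m] in_seqs lex_less_mirror_left by simp
      moreover have "d = a \<or> lex_less (mirror M d) (mirror M a)"
        using nl lex_less_linear d(1) in_seqs lex_less_mirror by blast
      ultimately have "lex_less (tail m d) (tail m a)"
        using d(3) lex_less_trans by auto
      then have "lex_less d a" using lex_less_tail[of m d a] d(2) by simp
      with nl show False by simp
    qed
    moreover have "lex_less (mirror M d) a"
      using mirror_first_less d(2)[of 0] assms(1)
      by (intro lex_lessI[of 0]) (auto simp: mirror_def)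
    ultimately show "lex_less (tail j d) a \<and> lex_less (mirror M (tail j d)) a"
      using 2 by simp
  next
    case 3
    have "lex_less_upto (m - j) (mirror M (tail j a)) a"
      using assms(2) 3 by (simp add: good_def)
    then have "lex_less_upto (m - j) (mirror M (tail j d)) a"
      by (rule lex_less_upto_cong) (auto simp: mirror_def tail_def d(2))
    moreover have "lex_less (tail j d) a"
      using not_lex_less_cases[OF tail_le[of j], of "m - j"]
    proof
      assume "lex_less_upto (m - j) (tail j a) a"
      then have "lex_less_upto (m - j) (tail j d) a"
        by (rule lex_less_upto_cong) (auto simp: tail_def d(2))
      then show ?thesis by (auto simp: lex_less_iff_upto)
    next
      assume eq: "\<forall>i<m - j. tail j a i = a i"
      \<comment> \<open>The tail at \<open>j\<close> now repeats the first \<open>m - j\<close>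
        digits of \<open>a\<close> and goes on with the reflected prefix. Goodness at
        \<open>m - j\<close> compares exactly the \<open>j\<close> digits of the prefix that
        remain.\<close>
      have "lex_less_upto j (mirror M (tail (m - j) a)) a"
        using assms(2) 3 unfolding good_def by (metis diff_diff_cancel diff_less less_imp_le less_trans)
      then have "lex_less_upto j (mirror M (tail (m - j) a)) d"
        by (rule lex_less_upto_cong) (use 3 d(2) in auto)
      then have "lex_less (mirror M (tail (m - j) a)) d" by (auto simp: lex_less_iff_upto)
      then have "lex_less (mirror M d) (tail (m - j) a)"
        using lex_less_mirror_left d(1) in_seqs by simp
      then have "lex_less (tail (m - j) (tail j d)) (tail (m - j) a)"
        using 3 by (simp add: d(3))
      then show ?thesis
        using lex_less_tail[of "m - j" "tail j d" a] eq by (simp add: tail_def d(2))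
    qed
    ultimately show "lex_less (tail j d) a \<and> lex_less (mirror M (tail j d)) a"
      by (auto simp: lex_less_iff_upto)
  qed
qed

text \<open>In the periodic case, all the strict inequalities between tails are visible within a uniformly
  bounded number of digits, so they survive a perturbation after a long good prefix.\<close>

lemma strongly_dominant_approx:
  "\<exists>e\<in>seqs M. (\<forall>i<N. e i = a i) \<and> strongly_dominant M e"
proof (cases "\<forall>k\<ge>1. lex_less (tail k a) a")
  case True
  then have "strongly_dominant M a" using mirror_tail_less by (simp add: strongly_dominant_def)
  then show ?thesis using in_seqs by auto
next
  case False
  then obtain n where n: "n \<ge> 1" "tail n a = a" using tail_le lex_less_linear by blast
  \<comment> \<open>\<open>L\<close> bounds the digits needed to separate \<open>mirror M a\<close>
    from the tails of \<open>a\<close>; \<open>T\<close> below does the same for the tails of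
    \<open>d\<close> against \<open>a\<close>.\<close>
  have "\<exists>L. lex_less_upto L (mirror M a) (tail s a)" for s
    using mirror_tail_less'[of s] lex_less_mirror_left[of a M "tail s a"] in_seqs
    by (simp add: lex_less_iff_upto)
  then obtain L where L: "lex_less_upto L (mirror M a) (tail s a)" for s
    using periodic_uniform_bound[OF n(2,1), of "\<lambda>T y. lex_less_upto T (mirror M a) y"]
      lex_less_upto_mono by blast
  obtain m where m: "m > L" "good m" using good_unbounded by blast
  define d where "d = alternating m"
  have m1: "m \<ge> 1" using m by simp
  have d: "d \<in> seqs M" "\<And>i. i < m \<Longrightarrow> d i = a i"
    using alternating_in_seqs alternating_prefix by (auto simp: d_def)
  have "\<exists>T. lex_less_upto T (tail s d) a \<and> lex_less_upto T (mirror M (tail s d)) a" for s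
  proof -
    obtain T1 T2 where "lex_less_upto T1 (tail s d) a" "lex_less_upto T2 (mirror M (tail s d)) a"
      using alternating_tails_less[OF m1 m(2), of s] by (auto simp: lex_less_iff_upto d_def)
    then show ?thesis by (metis lex_less_upto_mono max.cobounded1 max.cobounded2)
  qed
  then obtain T where T: "lex_less_upto T (tail s d) a" "lex_less_upto T (mirror M (tail s d)) a" for s
    using periodic_uniform_bound[OF tail_alternating_period[OF m1],
        of "\<lambda>T y. lex_less_upto T y a \<and> lex_less_upto T (mirror M y) a"] m1 lex_less_upto_mono
    unfolding d_def[symmetric] by (metis trans_le_add1)
  obtain k where k: "k > T + L + N" "good k" using good_unbounded by blast
  \<comment> \<open>The sequence \<open>d\<close> itself is periodic and hence not strongly
    dominant. A longer good prefix of \<open>a\<close> followed by the reflection of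
    \<open>d\<close> removes this periodicity.\<close>
  define e where "e = (\<lambda>i. if i < k then a i else M - d (i - k))"
  have e: "e \<in> seqs M" "\<And>i. i < k \<Longrightarrow> e i = a i"
    using digit_le by (auto simp: seqs_iff e_def)
  have ke: "tail k e = mirror M d" by (simp add: e_def tail_def mirror_def)
  have "lex_less (tail j e) e \<and> lex_less (mirror M (tail j e)) e" if j: "j \<ge> 1" for j
  proof (cases "j \<ge> k")
    case True
    then have te: "tail j e = mirror M (tail (j - k) d)"
      using tail_tail[of "j - k" k e] by (simp add: ke tail_mirror)
    have "lex_less_upto T (tail (j - k) d) e" "lex_less_upto T (mirror M (tail (j - k) d)) e"
      by (rule lex_less_upto_cong[OF T(1)] lex_less_upto_cong[OF T(2)]; use k e(2) in simp)+
    then show ?thesis using d(1) by (auto simp: te lex_less_iff_upto)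
  next
    case False
    have "lex_less_upto (k - j) (mirror M (tail j a)) a"
      using k(2) False by (simp add: good_def)
    then have "lex_less_upto (k - j) (mirror M (tail j e)) e"
      by (rule lex_less_upto_cong) (auto simp: mirror_def tail_def e(2))
    moreover have "lex_less (tail j e) e"
      using not_lex_less_cases[OF tail_le[of j], of "k - j"]
    proof
      assume "lex_less_upto (k - j) (tail j a) a"
      then have "lex_less_upto (k - j) (tail j e) e"
        by (rule lex_less_upto_cong) (auto simp: tail_def e(2))
      then show ?thesis by (auto simp: lex_less_iff_upto)
    next
      assume eq: "\<forall>i<k - j. tail j a i = a i"
      have "lex_less (mirror M d) (tail (k - j) e)"
      \<comment> \<open>For small \<open>j\<close>, goodness of \<open>k\<close> decides within the
        last \<open>j\<close> digits of the prefix, where \<open>d\<close> still agrees with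
        \<open>a\<close> because \<open>m > L\<close>. For large \<open>j\<close>, the bound
        \<open>L\<close> decides within these digits.\<close>
      proof (cases "j \<le> L")
        case True
        have "lex_less_upto j (mirror M (tail (k - j) a)) a"
          using k(2) False j unfolding good_def
          by (metis diff_diff_cancel diff_less less_imp_le linorder_not_le less_le_trans zero_less_one)
        then have "lex_less_upto j (mirror M (tail (k - j) e)) d"
          by (rule lex_less_upto_cong) (use True m False d(2) e(2) in \<open>auto simp: mirror_def tail_def\<close>)
        then have "lex_less (mirror M (tail (k - j) e)) d" by (auto simp: lex_less_iff_upto)
        then show ?thesis
          using lex_less_mirror_left d(1) e(1) by simp
      next
        case jL: False
        have "lex_less_upto L (mirror M d) (tail (k - j) e)"
          by (rule lex_less_upto_cong[OF L[of "k - j"]])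
            (use jL m False d(2) e(2) in \<open>auto simp: mirror_def tail_def\<close>)
        then show ?thesis by (auto simp: lex_less_iff_upto)
      qed
      then have "lex_less (tail (k - j) (tail j e)) (tail (k - j) e)"
        using False by (simp add: ke)
      then show ?thesis
        using lex_less_tail[of "k - j" "tail j e" e] eq by (simp add: tail_def e(2))
    qed
    ultimately show ?thesis by (auto simp: lex_less_iff_upto)
  qed
  then have "strongly_dominant M e" by (simp add: strongly_dominant_def)
  moreover have "\<forall>i<N. e i = a i" using k(1) e(2) by simp
  ultimately show ?thesis using e(1) by blast
qed

end

section \<open>Values of digit sequences\<close>

definition val :: "real \<Rightarrow> (nat \<Rightarrow> nat) \<Rightarrow> real" where
  "val q c = (\<Sum>i. real (c i) / q ^ (i + 1))"

lemma sums_const_digit: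
  assumes "q > 1"
  shows "(\<lambda>i. real M / q ^ (i + 1)) sums (real M / (q - 1))"
proof -
  have "(\<lambda>i. (1 / q) ^ i) sums (1 / (1 - 1 / q))"
    using assms by (intro geometric_sums) auto
  then have "(\<lambda>i. (real M / q) * (1 / q) ^ i) sums ((real M / q) * (1 / (1 - 1 / q)))"
    by (rule sums_mult)
  moreover have "(real M / q) * (1 / (1 - 1 / q)) = real M / (q - 1)"
    using assms by (simp add: field_simps)
  moreover have "(\<lambda>i. (real M / q) * (1 / q) ^ i) = (\<lambda>i. real M / q ^ (i + 1))"
    by (simp add: power_one_over field_simps)
  ultimately show ?thesis by metis
qed

lemma summable_val:
  assumes "q > 1" "c \<in> seqs M"
  shows "summable (\<lambda>i. real (c i) / q ^ (i + 1))"
proof (rule summable_comparison_test')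
  show "summable (\<lambda>i. real M / q ^ (i + 1))"
    using sums_const_digit[OF assms(1)] by (rule sums_summable)
  show "norm (real (c i) / q ^ (i + 1)) \<le> real M / q ^ (i + 1)" if "i \<ge> 0" for i
    using assms by (auto simp: seqs_iff intro!: divide_right_mono)
qed

lemma is_expansion_iff_val:
  assumes "q > 1"
  shows "is_expansion M q c x \<longleftrightarrow> c \<in> seqs M \<and> val q c = x"
  using summable_val[OF assms] sums_iff by (auto simp: is_expansion_def val_def)

lemma val_split:
  assumes "q > 1" "c \<in> seqs M"
  shows "val q c = (real (c 0) + val q (tail 1 c)) / q"
proof -
  have "val q c = real (c 0) / q + (\<Sum>i. real (c (Suc i)) / q ^ (Suc i + 1))"
    using suminf_split_head[OF summable_val[OF assms]] by (simp add: val_def)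
  also have "(\<Sum>i. real (c (Suc i)) / q ^ (Suc i + 1)) = (\<Sum>i. (real (tail 1 c i) / q ^ (i + 1)) / q)"
    by (simp add: tail_def mult_ac)
  also have "\<dots> = val q (tail 1 c) / q"
    unfolding val_def using assms by (intro suminf_divide summable_val[where M = M]) auto
  finally show ?thesis by (simp add: add_divide_distrib)
qed

lemma val_tail_split:
  assumes "q > 1" "c \<in> seqs M"
  shows "val q (tail k c) = (real (c k) + val q (tail (Suc k) c)) / q"
proof -
  have "tail k c 0 = c k" by (simp add: tail_def)
  then show ?thesis using val_split[of q "tail k c" M] assms by simp
qed

lemma val_nonneg: "q > 1 \<Longrightarrow> c \<in> seqs M \<Longrightarrow> 0 \<le> val q c"
  unfolding val_def by (intro suminf_nonneg summable_val) auto

lemma val_mirror: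
  assumes "q > 1" "c \<in> seqs M"
  shows "val q (mirror M c) = real M / (q - 1) - val q c"
proof -
  have "(\<lambda>i. real M / q ^ (i + 1) - real (c i) / q ^ (i + 1)) sums (real M / (q - 1) - val q c)"
    unfolding val_def
    by (intro sums_diff sums_const_digit assms summable_sums summable_val[OF assms])
  moreover have "(\<lambda>i. real M / q ^ (i + 1) - real (c i) / q ^ (i + 1))
      = (\<lambda>i. real (mirror M c i) / q ^ (i + 1))"
    using assms(2) by (auto simp: mirror_def seqs_iff of_nat_diff diff_divide_distrib)
  ultimately show ?thesis by (simp add: val_def sums_iff)
qed

lemma val_le: "q > 1 \<Longrightarrow> c \<in> seqs M \<Longrightarrow> val q c \<le> real M / (q - 1)"
  using val_mirror[of q c M] val_nonneg[of q "mirror M c" M] by simp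

lemma val_diff:
  assumes "q > 1" "c \<in> seqs M" "d \<in> seqs M" "\<And>i. i < k \<Longrightarrow> c i = d i"
  shows "val q c - val q d = (val q (tail k c) - val q (tail k d)) / q ^ k"
  using assms(4)
proof (induction k)
  case (Suc k)
  have "val q (tail k c) = (real (c k) + val q (tail (Suc k) c)) / q"
       "val q (tail k d) = (real (d k) + val q (tail (Suc k) d)) / q"
    using val_tail_split assms(1-3) by blast+
  moreover have "c k = d k" using Suc.prems by simp
  moreover have "val q c - val q d = (val q (tail k c) - val q (tail k d)) / q ^ k"
    using Suc by simp
  ultimately have "val q c - val q d
      = ((real (c k) + val q (tail (Suc k) c)) / q - (real (c k) + val q (tail (Suc k) d)) / q) / q ^ k"
    by simp
  then show ?case using assms(1) by (simp add: diff_divide_distrib[symmetric])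
qed simp

lemma val_diff_digit:
  assumes "q > 1" "c \<in> seqs M" "d \<in> seqs M" "\<And>i. i < k \<Longrightarrow> c i = d i"
  shows "val q c - val q d
     = (real (c k) - real (d k) + val q (tail (Suc k) c) - val q (tail (Suc k) d)) / q ^ Suc k"
proof -
  have "val q (tail k c) = (real (c k) + val q (tail (Suc k) c)) / q"
       "val q (tail k d) = (real (d k) + val q (tail (Suc k) d)) / q"
    using val_tail_split assms(1-3) by blast+
  then have "val q c - val q d
      = ((real (c k) + val q (tail (Suc k) c)) / q - (real (d k) + val q (tail (Suc k) d)) / q) / q ^ k"
    using val_diff[OF assms] by simp
  then show ?thesis
    using assms(1) by (simp add: diff_divide_distrib[symmetric] algebra_simps)
qed

text \<open>The error \<open>r n - val q (tail n c)\<close> is multiplied by \<open>q\<close> in each step, so boundedness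
  forces it to vanish.\<close>

lemma val_tail_eq_remainder:
  assumes q: "q > 1" and c: "c \<in> seqs M"
    and step: "\<And>n. r (Suc n) = q * r n - real (c n)"
    and bound: "\<And>n. 0 \<le> r n \<and> r n \<le> B"
  shows "val q (tail n c) = r n"
proof -
  define D where "D n = r n - val q (tail n c)" for n
  have "D (Suc n) = q * D n" for n
    using val_tail_split[OF q c, of n] q by (simp add: D_def step field_simps)
  then have pow: "D (n + k) = q ^ k * D n" for k by (induction k) (auto simp: algebra_simps)
  have bd: "\<bar>D n\<bar> \<le> B + real M / (q - 1)" for n
    using bound[of n] val_nonneg[of q "tail n c" M] val_le[of q "tail n c" M] q c
    by (auto simp: D_def abs_le_iff)
  have "D n = 0"
  proof (rule ccontr)
    assume "D n \<noteq> 0"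
    obtain k where "(B + real M / (q - 1)) / \<bar>D n\<bar> < q ^ k"
      using real_arch_pow[OF q] by blast
    then have "B + real M / (q - 1) < q ^ k * \<bar>D n\<bar>"
      using \<open>D n \<noteq> 0\<close> by (simp add: pos_divide_less_eq)
    then have "B + real M / (q - 1) < \<bar>D (n + k)\<bar>"
      using q by (simp only: pow abs_mult) simp
    with bd show False using not_le by blast
  qed
  then show ?thesis by (simp add: D_def)
qed

text \<open>Greedy algorithm with digits capped at \<open>M\<close>. An uncapped step leaves a
  remainder of at most 1, which is admissible because \<open>q \<le> M + 1\<close>; a capped step
  preserves the upper bound, as \<open>M / (q - 1)\<close> is fixed by \<open>y\<close> mapped to
  \<open>q * y - M\<close>.\<close>

lemma expansion_exists:
  assumes q: "1 < q" "q \<le> real M + 1" and x: "0 \<le> x" "x \<le> real M / (q - 1)"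
  shows "\<exists>c\<in>seqs M. val q c = x"
proof -
  define dig where "dig y = min (int M) \<lfloor>q * y\<rfloor>" for y
  define r where "r = rec_nat x (\<lambda>_ y. q * y - of_int (dig y))"
  define c where "c = (\<lambda>n. nat (dig (r n)))"
  have r0: "r 0 = x" and rS: "r (Suc n) = q * r n - of_int (dig (r n))" for n
    by (simp_all add: r_def)
  have one: "1 \<le> real M / (q - 1)" using q by (simp add: field_simps)
  have bound: "0 \<le> r n \<and> r n \<le> real M / (q - 1)" for n
  proof (induction n)
    case (Suc n)
    show ?case
    proof (cases "\<lfloor>q * r n\<rfloor> \<le> int M")
      case True
      then have d: "dig (r n) = \<lfloor>q * r n\<rfloor>" by (simp add: dig_def)
      have "0 \<le> q * r n - of_int \<lfloor>q * r n\<rfloor>" "q * r n - of_int \<lfloor>q * r n\<rfloor> \<le> 1" by linarith+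
      then show ?thesis unfolding rS d using one by linarith
    next
      case False
      then have d: "dig (r n) = int M" by (simp add: dig_def)
      have "real M \<le> q * r n" using False by linarith
      moreover have "q * r n \<le> q * (real M / (q - 1))"
        using Suc q by (intro mult_left_mono) auto
      moreover have "q * (real M / (q - 1)) - real M = real M / (q - 1)"
        using q by (simp add: field_simps)
      ultimately show ?thesis unfolding rS d by simp
    qed
  qed (use x r0 in simp)
  have dig: "0 \<le> dig (r n)" for n
    using bound[of n] q by (simp add: dig_def)
  have c: "c \<in> seqs M" by (auto simp: seqs_iff c_def dig_def)
  have "r (Suc n) = q * r n - real (c n)" for n
    using dig[of n] by (simp add: rS c_def)
  then have "val q (tail 0 c) = r 0"
    using bound q c by (intro val_tail_eq_remainder[where B = "real M / (q - 1)"]) auto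
  then show ?thesis using c r0 by auto
qed

section \<open>Unique expansions and the values of their tails\<close>

text \<open>At the first difference from a rival expansion the digits differ by at least 1. The tail
  of \<open>c\<close> is too small to make up for a larger rival digit, and its reflection too small
  to make up for a smaller one.\<close>

lemma unique_expansionsI:
  assumes q: "1 < q" and c: "c \<in> seqs M"
    and up: "\<And>j. c j < M \<Longrightarrow> val q (tail (Suc j) c) < 1"
    and down: "\<And>j. c j > 0 \<Longrightarrow> val q (mirror M (tail (Suc j) c)) < 1"
  shows "c \<in> unique_expansions M q"
proof -
  have "d = c" if d: "d \<in> seqs M" "val q d = val q c" for d
  proof (rule ccontr)
    assume "d \<noteq> c"
    then have "lex_less c d \<or> lex_less d c" using lex_less_linear by blast
    then obtain k where k: "\<And>l. l < k \<Longrightarrow> c l = d l" "c k \<noteq> d k"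
      unfolding lex_less_def by (metis less_irrefl)
    have "(real (c k) - real (d k) + val q (tail (Suc k) c) - val q (tail (Suc k) d)) / q ^ Suc k = 0"
      using val_diff_digit[OF q c d(1) k(1)] d(2) by simp
    then have eq: "real (c k) + val q (tail (Suc k) c) = real (d k) + val q (tail (Suc k) d)"
      using q by simp
    have dM: "d k \<le> M" using d(1) by (simp add: seqs_iff)
    show False
    proof (cases "c k < d k")
      case True
      then have "real (c k) + 1 \<le> real (d k)" by simp
      then show False
        using up[of k] True dM eq val_nonneg[of q "tail (Suc k) d" M] q d(1) by simp
    next
      case False
      then have "real (d k) + 1 \<le> real (c k)" "c k > 0" using k(2) by auto
      then show False
        using down[of k] eq val_le[of q "tail (Suc k) d" M] val_mirror[of q "tail (Suc k) c" M]
          q d(1) c by simp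
    qed
  qed
  then show ?thesis
    using val_nonneg[OF q c] val_le[OF q c] q c
    by (auto simp: unique_expansions_def J_def is_expansion_iff_val)
qed

lemma unique_expansions_in_seqs: "c \<in> unique_expansions M q \<Longrightarrow> c \<in> seqs M"
  by (auto simp: unique_expansions_def is_expansion_def)

lemma unique_expansions_eqI:
  assumes "1 < q" "c \<in> unique_expansions M q" "d \<in> seqs M" "val q d = val q c"
  shows "d = c"
  using assms by (auto simp: unique_expansions_def is_expansion_iff_val)

text \<open>If the tail had value at least 1, one could increase the preceding digit by 1 and expand the
  remaining value anew.\<close>

lemma unique_expansions_tail_less:
  assumes q: "1 < q" "q \<le> real M + 1" and c: "c \<in> unique_expansions M q" and j: "c j < M"
  shows "val q (tail (Suc j) c) < 1"
proof (rule ccontr)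
  assume ge: "\<not> ?thesis"
  have cs: "c \<in> seqs M" using c by (rule unique_expansions_in_seqs)
  obtain b where b: "b \<in> seqs M" "val q b = val q (tail (Suc j) c) - 1"
    using expansion_exists[OF q, of "val q (tail (Suc j) c) - 1"] ge
      val_le[of q "tail (Suc j) c" M] cs q by auto
  define d where "d = (\<lambda>i. if i < j then c i else if i = j then Suc (c j) else b (i - Suc j))"
  have d: "d \<in> seqs M" using cs b(1) j by (auto simp: seqs_iff d_def)
  have "tail (Suc j) d = b" by (auto simp: tail_def d_def)
  then have "val q c - val q d = 0"
    using val_diff_digit[of q c M d j] q cs d b(2) by (simp add: d_def)
  then have "d = c" using unique_expansions_eqI[OF q(1) c d] by simp
  then have "d j = c j" by simp
  then show False by (simp add: d_def)
qed

lemma mirror_unique_expansions: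
  assumes q: "1 < q" and c: "c \<in> unique_expansions M q"
  shows "mirror M c \<in> unique_expansions M q"
proof -
  have cs: "c \<in> seqs M" using c by (rule unique_expansions_in_seqs)
  have "d = mirror M c" if d: "d \<in> seqs M" "val q d = val q (mirror M c)" for d
  proof -
    have "mirror M d = c"
      using val_mirror[of q d M] val_mirror[of q c M] cs d q
      by (intro unique_expansions_eqI[OF q c]) auto
    then show ?thesis using d(1) by auto
  qed
  then show ?thesis
    using val_nonneg[of q "mirror M c" M] val_le[of q "mirror M c" M] q
    by (auto simp: unique_expansions_def J_def is_expansion_iff_val)
qed

lemma unique_expansions_mirror_tail_less:
  assumes q: "1 < q" "q \<le> real M + 1" and c: "c \<in> unique_expansions M q" and j: "c j > 0"
  shows "val q (mirror M (tail (Suc j) c)) < 1"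
proof -
  have "mirror M c j < M"
    using j unique_expansions_in_seqs[OF c] by (auto simp: mirror_def seqs_iff) (metis diff_less le_trans not_gr0 leD)
  then show ?thesis
    using unique_expansions_tail_less[OF q mirror_unique_expansions[OF q(1) c]]
    by (simp add: tail_mirror)
qed

text \<open>The bound survives a digit 0: if \<open>(M + y) / q < 1\<close>, then
  \<open>y < q - M \<le> 1\<close>. So one nonzero digit controls all later reflected tails.\<close>

lemma unique_expansions_mirror_tail_less':
  assumes q: "1 < q" "q \<le> real M + 1" and c: "c \<in> unique_expansions M q"
    and i: "c i > 0" and j: "i < j"
  shows "val q (mirror M (tail j c)) < 1"
  using j
proof (induction j)
  case (Suc j)
  show ?case
  proof (cases "c j > 0")
    case True
    then show ?thesis using unique_expansions_mirror_tail_less[OF q c] by simp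
  next
    case False
    then have "i \<noteq> j" using i by auto
    then have "val q (mirror M (tail j c)) < 1" using Suc by simp
    moreover have "val q (mirror M (tail j c)) = (real M + val q (mirror M (tail (Suc j) c))) / q"
      using val_tail_split[of q "mirror M c" M j] q(1) False
      by (simp add: tail_mirror) (simp add: mirror_def)
    ultimately show ?thesis using q by (simp add: field_simps)
  qed
qed simp

text \<open>Each tail that is smaller than \<open>e\<close> splits into a prefix whose last digit is below \<open>M\<close>,
  followed by another tail of this kind. Hence the supremum \<open>S\<close> of the values of these tails
  satisfies \<open>S - 1 \<le> max 0 ((S - 1) / q)\<close>.\<close>

lemma val_tail_less_one:
  assumes q: "1 < q" and e: "e \<in> seqs M" "val q e = 1" "\<And>k. 0 < val q (tail k e)"
    and c: "c \<in> seqs M" and lex: "\<And>j. c j < M \<Longrightarrow> lex_less (tail (Suc j) c) e"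
    and j: "c j < M"
  shows "val q (tail (Suc j) c) < 1"
proof -
  define V where "V = {val q (tail (Suc j) c) | j. c j < M}"
  define S where "S = Sup V"
  have bdd: "bdd_above V"
    using val_le q c by (intro bdd_aboveI[of _ "real M / (q - 1)"]) (auto simp: V_def)
  have leS: "val q (tail (Suc j) c) \<le> S" if "c j < M" for j
    unfolding S_def using that by (intro cSup_upper bdd) (auto simp: V_def)
  have key: "\<exists>k. val q (tail (Suc j) c) - 1 < (S - 1) / q ^ Suc k" if j: "c j < M" for j
  proof -
    obtain k where k: "\<forall>l<k. tail (Suc j) c l = e l" "tail (Suc j) c k < e k"
      using lex[OF j] by (auto simp: lex_less_def)
    have "c (Suc j + k) < M" using k(2) e(1) by (auto simp: tail_def seqs_iff intro: less_le_trans)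
    then have "val q (tail (Suc (Suc j + k)) c) \<le> S" by (rule leS)
    moreover have "real (tail (Suc j) c k) + 1 \<le> real (e k)" using k(2) by simp
    ultimately have "real (tail (Suc j) c k) - real (e k) + val q (tail (Suc k) (tail (Suc j) c))
        - val q (tail (Suc k) e) < S - 1"
      using e(3)[of "Suc k"] by simp
    then have "val q (tail (Suc j) c) - val q e < (S - 1) / q ^ Suc k"
      using val_diff_digit[of q "tail (Suc j) c" M e k] q c e(1) k(1)
      by (simp add: divide_strict_right_mono)
    then show ?thesis using e(2) by auto
  qed
  have "S \<le> 1"
  proof (rule ccontr)
    assume S: "\<not> S \<le> 1"
    have "v \<le> 1 + (S - 1) / q" if v: "v \<in> V" for v
    proof -
      obtain j where j: "c j < M" "v = val q (tail (Suc j) c)" using v by (auto simp: V_def)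
      obtain k where "v - 1 < (S - 1) / q ^ Suc k" using key j by auto
      also have "\<dots> \<le> (S - 1) / q"
        using S q one_le_power[of q k] by (intro divide_left_mono) auto
      finally show ?thesis by simp
    qed
    then have "S \<le> 1 + (S - 1) / q"
      unfolding S_def using j by (intro cSup_least) (auto simp: V_def)
    then have "(S - 1) * q \<le> S - 1" using q by (simp add: field_simps)
    then show False using S q by (simp add: mult_le_cancel_left1)
  qed
  \<comment> \<open>The strict estimate is used once more, now with \<open>S \<le> 1\<close>, to
    recover strictness.\<close>
  obtain k where "val q (tail (Suc j) c) - 1 < (S - 1) / q ^ Suc k" using key[OF j] by auto
  moreover have "(S - 1) / q ^ Suc k \<le> 0"
    using \<open>S \<le> 1\<close> q by (intro divide_nonpos_pos) auto
  ultimately show ?thesis by simp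
qed

text \<open>\<open>val_tail_less_one\<close> is applied to \<open>c\<close> and to its reflection.
  Leaving \<open>e\<close> general covers both the quasi-greedy expansion and the strongly dominant
  sequences.\<close>

lemma unique_expansions_lexI:
  assumes q: "1 < q" and e: "e \<in> seqs M" "val q e = 1" "\<And>k. 0 < val q (tail k e)"
    and c: "c \<in> seqs M"
    and up: "\<And>j. c j < M \<Longrightarrow> lex_less (tail (Suc j) c) e"
    and down: "\<And>j. c j > 0 \<Longrightarrow> lex_less (mirror M (tail (Suc j) c)) e"
  shows "c \<in> unique_expansions M q"
proof (rule unique_expansionsI[OF q c])
  show "val q (tail (Suc j) c) < 1" if "c j < M" for j
    using q e c up that by (rule val_tail_less_one)
  show "val q (mirror M (tail (Suc j) c)) < 1" if "c j > 0" for j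
  proof -
    have cj: "c j \<le> M" using c by (simp add: seqs_iff)
    have "val q (tail (Suc j) (mirror M c)) < 1"
    proof (rule val_tail_less_one[OF q e])
      show "lex_less (tail (Suc i) (mirror M c)) e" if "mirror M c i < M" for i
      proof -
        have "c i > 0" using that by (cases "c i = 0") (auto simp: mirror_def)
        then show ?thesis using down by (simp add: tail_mirror)
      qed
      show "mirror M c j < M" using that cj by (simp add: mirror_def)
    qed simp
    then show ?thesis by (simp add: tail_mirror)
  qed
qed

section \<open>The quasi-greedy expansion of 1\<close>

text \<open>The digit removed is the largest integer strictly below \<open>q * qrem q n\<close>, so
  no remainder ever vanishes; the floor would allow remainder 0.\<close>

primrec qrem :: "real \<Rightarrow> nat \<Rightarrow> real" where
  "qrem q 0 = 1"
| "qrem q (Suc n) = q * qrem q n - (of_int \<lceil>q * qrem q n\<rceil> - 1)"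

definition qgreedy :: "real \<Rightarrow> nat \<Rightarrow> nat" where
  "qgreedy q n = nat (\<lceil>q * qrem q n\<rceil> - 1)"

lemma qrem_bounds: "0 < qrem q n \<and> qrem q n \<le> 1"
proof (cases n)
  case (Suc k)
  have "0 < q * qrem q k - (of_int \<lceil>q * qrem q k\<rceil> - 1)"
       "q * qrem q k - (of_int \<lceil>q * qrem q k\<rceil> - 1) \<le> 1" by linarith+
  then show ?thesis by (simp add: Suc)
qed simp

lemma qrem_Suc:
  assumes "1 < q"
  shows "qrem q (Suc n) = q * qrem q n - real (qgreedy q n)"
proof -
  have "0 < q * qrem q n" using assms qrem_bounds by simp
  then have "\<lceil>q * qrem q n\<rceil> \<ge> 1" by linarith
  then show ?thesis by (simp add: qgreedy_def)
qed

lemma qgreedy_in_seqs: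
  assumes "1 < q" "q \<le> real M + 1"
  shows "qgreedy q \<in> seqs M"
proof -
  have "\<lceil>q * qrem q n\<rceil> \<le> int M + 1" for n
  proof -
    have "q * qrem q n \<le> q * 1" using qrem_bounds assms by (intro mult_left_mono) auto
    then show ?thesis using assms by linarith
  qed
  then have "\<lceil>q * qrem q n\<rceil> - 1 \<le> int M" for n by (simp add: algebra_simps)
  then show ?thesis by (simp add: seqs_iff qgreedy_def nat_le_iff)
qed

lemma qgreedy_first_pos:
  assumes "1 < q"
  shows "qgreedy q 0 > 0"
  using assms by (simp add: qgreedy_def)

section \<open>Lexicographic conditions in a fixed base\<close>

locale quasi_greedy =
  fixes M :: nat and q :: real
  assumes q: "1 < q" "q \<le> real M + 1"
begin

lemma qgreedy_seqs: "qgreedy q \<in> seqs M"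
  using q by (rule qgreedy_in_seqs)

lemma val_tail_qgreedy: "val q (tail n (qgreedy q)) = qrem q n"
  using q(1) qgreedy_seqs qrem_Suc[OF q(1)] qrem_bounds
  by (intro val_tail_eq_remainder[where B = 1 and M = M]) (auto intro: less_imp_le)

lemma val_qgreedy: "val q (qgreedy q) = 1"
  using val_tail_qgreedy[of 0] by simp

lemma val_tail_qgreedy_pos: "0 < val q (tail n (qgreedy q))"
  using val_tail_qgreedy qrem_bounds by simp

text \<open>At the first difference \<open>c\<close> gains at least 1, while the quasi-greedy tail
  given up is worth at most 1; what remains is the tail of \<open>c\<close>. A nonnegative tail
  excludes \<open>val q c < 1\<close>, a positive one even \<open>val q c \<le> 1\<close>.\<close>

lemma val_excess_ge:
  assumes c: "c \<in> seqs M" and less: "lex_less (qgreedy q) c"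
  shows "\<exists>k. val q (tail k c) / q ^ k \<le> val q c - 1"
proof -
  obtain k where k: "\<forall>l<k. c l = qgreedy q l" "qgreedy q k < c k"
    using less unfolding lex_less_def by metis
  have "real (qgreedy q k) + 1 \<le> real (c k)" using k(2) by simp
  then have "val q (tail (Suc k) c) \<le> real (c k) - real (qgreedy q k) + val q (tail (Suc k) c)
      - val q (tail (Suc k) (qgreedy q))"
    using val_tail_qgreedy[of "Suc k"] qrem_bounds[of q "Suc k"] by linarith
  then have "val q (tail (Suc k) c) / q ^ Suc k \<le> val q c - val q (qgreedy q)"
    using val_diff_digit[OF q(1) c qgreedy_seqs, of k] k(1) q(1)
    by (simp only:) (intro divide_right_mono, auto)
  then show ?thesis using val_qgreedy by metis
qed

lemma lex_less_qgreedy: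
  assumes "c \<in> seqs M" "val q c < 1"
  shows "lex_less c (qgreedy q)"
proof (rule ccontr)
  assume "\<not> ?thesis"
  moreover have "c \<noteq> qgreedy q" using assms(2) val_qgreedy by auto
  ultimately have "lex_less (qgreedy q) c" using lex_less_linear by blast
  then obtain k where k: "val q (tail k c) / q ^ k \<le> val q c - 1" using val_excess_ge assms(1) by blast
  moreover have "0 \<le> val q (tail k c) / q ^ k"
    using val_nonneg[of q "tail k c" M] q(1) assms(1) by simp
  ultimately show False using assms(2) by simp
qed

lemma qgreedy_tail_le: "\<not> lex_less (qgreedy q) (tail k (qgreedy q))"
proof
  assume "lex_less (qgreedy q) (tail k (qgreedy q))"
  then obtain j where "val q (tail j (tail k (qgreedy q))) / q ^ j \<le> val q (tail k (qgreedy q)) - 1"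
    using val_excess_ge qgreedy_seqs tail_in_seqs by blast
  moreover have "0 < val q (tail j (tail k (qgreedy q))) / q ^ j"
    using val_tail_qgreedy_pos q(1) by simp
  ultimately show False using val_tail_qgreedy[of k] qrem_bounds[of q k] by simp
qed

lemma unique_expansions_tail_lex:
  assumes "c \<in> unique_expansions M q" "c j < M"
  shows "lex_less (tail (Suc j) c) (qgreedy q)"
  using assms unique_expansions_tail_less[OF q] unique_expansions_in_seqs
  by (intro lex_less_qgreedy) auto

lemma unique_expansions_mirror_tail_lex:
  assumes "c \<in> unique_expansions M q" "c i > 0" "i < j"
  shows "lex_less (mirror M (tail j c)) (qgreedy q)"
  using assms unique_expansions_mirror_tail_less'[OF q] by (intro lex_less_qgreedy) auto

lemma unique_expansions_qgreedyI:
  assumes "c \<in> seqs M"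
    "\<And>j. c j < M \<Longrightarrow> lex_less (tail (Suc j) c) (qgreedy q)"
    "\<And>j. c j > 0 \<Longrightarrow> lex_less (mirror M (tail (Suc j) c)) (qgreedy q)"
  shows "c \<in> unique_expansions M q"
  using q(1) qgreedy_seqs val_qgreedy val_tail_qgreedy_pos assms by (rule unique_expansions_lexI)

lemma dominant_qgreedy_iff:
  "dominant M (qgreedy q) \<longleftrightarrow> (\<forall>k\<ge>1. lex_less (mirror M (tail k (qgreedy q))) (qgreedy q))"
  using qgreedy_seqs qgreedy_tail_le by (auto simp: dominant_def)

text \<open>A tail of a unique expansion starting with the first \<open>k\<close> digits of the quasi-greedy
  expansion would have to continue by something below the reflected quasi-greedy expansion, so
  comparing \<open>k\<close> digits decides membership.\<close>

lemma finite_type_if_not_dominant: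
  assumes "\<not> dominant M (qgreedy q)"
  shows "is_shift_of_finite_type M (unique_expansions M q)"
proof -
  define a where "a = qgreedy q"
  define U where "U = unique_expansions M q"
  obtain k where k: "k \<ge> 1" "\<not> lex_less (mirror M (tail k a)) a"
    using assms dominant_qgreedy_iff a_def by auto
  have a: "a \<in> seqs M" using qgreedy_seqs a_def by simp
  have ka: "\<not> lex_less (mirror M a) (tail k a)"
    using k(2) lex_less_mirror_left[of a M "tail k a"] a by simp
  have up: "lex_less_upto k (tail (Suc j) c) a" if c: "c \<in> U" "c j < M" for c j
  proof (rule ccontr)
    assume "\<not> ?thesis"
    have less: "lex_less (tail (Suc j) c) a"
      using unique_expansions_tail_lex c by (simp add: U_def a_def)
    with \<open>\<not> ?thesis\<close> have eq: "\<forall>i<k. tail (Suc j) c i = a i"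
      using not_lex_less_cases lex_less_asym by blast
    \<comment> \<open>The matched prefix begins with the positive first digit of \<open>a\<close>.
      This nonzero digit makes the reflected condition available after the prefix.\<close>
    then have "c (Suc j) > 0"
      using k(1) qgreedy_first_pos[OF q(1)] by (auto simp: tail_def a_def dest!: spec[of _ 0])
    then have "lex_less (mirror M (tail (Suc j + k) c)) a"
      using unique_expansions_mirror_tail_lex[of c "Suc j" "Suc j + k"] c(1) k(1)
      by (simp add: U_def a_def)
    moreover have "tail (Suc j + k) c \<in> seqs M"
      using c(1) unique_expansions_in_seqs by (auto simp: U_def)
    ultimately have "lex_less (mirror M a) (tail (Suc j + k) c)"
      using lex_less_mirror_left a by blast
    moreover have "lex_less (tail (Suc j + k) c) (tail k a)"
      using less lex_less_tail[of k "tail (Suc j) c" a] eq by simp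
    ultimately show False using ka lex_less_trans by blast
  qed
  have down: "lex_less_upto k (mirror M (tail (Suc j) c)) a" if c: "c \<in> U" "c j > 0" for c j
  proof -
    have "mirror M c \<in> U" using c(1) mirror_unique_expansions[OF q(1)] by (simp add: U_def)
    moreover have "c j \<le> M" using unique_expansions_in_seqs c(1) by (auto simp: U_def seqs_iff)
    then have "mirror M c j < M" using c(2) by (simp add: mirror_def)
    ultimately show ?thesis using up by (simp add: tail_mirror[symmetric])
  qed
  \<comment> \<open>The forbidden words are those occurring in no unique expansion. Length
    \<open>Suc k\<close> covers the digit that triggers a condition and the \<open>k\<close> digits
    compared after it.\<close>
  define F where "F = {w. set w \<subseteq> digits M \<and> length w = Suc k \<and>
     (\<forall>c\<in>U. \<forall>i. map c [i..<i + Suc k] \<noteq> w)}"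
  have "finite {w. set w \<subseteq> digits M \<and> length w = Suc k}"
    by (rule finite_lists_length_eq) (simp add: digits_def)
  then have "finite F" by (rule rev_finite_subset) (auto simp: F_def)
  moreover have "F \<subseteq> nonempty_words M" by (auto simp: F_def nonempty_words_def)
  moreover have "U = shift_of M F"
  proof
    show "U \<subseteq> shift_of M F"
      using unique_expansions_in_seqs by (auto simp: shift_of_def F_def U_def)
    show "shift_of M F \<subseteq> U"
    proof
      fix c assume "c \<in> shift_of M F"
      then have c: "c \<in> seqs M" "\<And>i n. n \<ge> 1 \<Longrightarrow> map c [i..<i + n] \<notin> F"
        by (auto simp: shift_of_def)
      have block: "\<exists>d\<in>U. \<exists>i. \<forall>l\<le>k. d (i + l) = c (j + l)" for j
      proof -
        have "set (map c [j..<j + Suc k]) \<subseteq> digits M" using c(1) by (auto simp: seqs_def)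
        then obtain d i where d: "d \<in> U" "map d [i..<i + Suc k] = map c [j..<j + Suc k]"
          using c(2)[of "Suc k" j] by (auto simp: F_def)
        have "d (i + l) = c (j + l)" if "l \<le> k" for l
          using arg_cong[OF d(2), of "\<lambda>w. w ! l"] that by (simp del: upt_Suc)
        then show ?thesis using d(1) by blast
      qed
      have "lex_less (tail (Suc j) c) a" if j: "c j < M" for j
      proof -
        obtain d i where d: "d \<in> U" "\<forall>l\<le>k. d (i + l) = c (j + l)" using block by blast
        have "lex_less_upto k (tail (Suc i) d) a"
          using up[OF d(1)] d(2) j by (metis add_0_right le0)
        then have "lex_less_upto k (tail (Suc j) c) a"
          by (rule lex_less_upto_cong) (use d(2)[rule_format, of "Suc _"] in \<open>auto simp: tail_def\<close>)
        then show ?thesis by (auto simp: lex_less_iff_upto)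
      qed
      moreover have "lex_less (mirror M (tail (Suc j) c)) a" if j: "c j > 0" for j
      proof -
        obtain d i where d: "d \<in> U" "\<forall>l\<le>k. d (i + l) = c (j + l)" using block by blast
        have "lex_less_upto k (mirror M (tail (Suc i) d)) a"
          using down[OF d(1)] d(2) j by (metis add_0_right le0)
        then have "lex_less_upto k (mirror M (tail (Suc j) c)) a"
          by (rule lex_less_upto_cong)
            (use d(2)[rule_format, of "Suc _"] in \<open>auto simp: tail_def mirror_def\<close>)
        then show ?thesis by (auto simp: lex_less_iff_upto)
      qed
      ultimately show "c \<in> U"
        using unique_expansions_qgreedyI[OF c(1)] by (simp add: U_def a_def)
    qed
  qed
  ultimately show ?thesis by (auto simp: is_shift_of_finite_type_def U_def)
qed

end

section \<open>Cylinders and closedness\<close>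

lemma openin_cylinder:
  assumes "c \<in> seqs M"
  shows "openin (seq_topology M) {d \<in> seqs M. \<forall>l<n. d l = c l}"
proof -
  define B where "B l = (if l < n then {c l} else digits M)" for l :: nat
  have "openin (seq_topology M) (Pi\<^sub>E UNIV B)"
    unfolding seq_topology_def
  proof (rule product_topology_basis)
    show "openin (discrete_topology (digits M)) (B l)" for l
      using assms by (simp add: B_def seqs_def)
    show "finite {l. B l \<noteq> topspace (discrete_topology (digits M))}"
      by (rule finite_subset[of _ "{..<n}"]) (auto simp: B_def)
  qed
  moreover have "Pi\<^sub>E UNIV B = {d \<in> seqs M. \<forall>l<n. d l = c l}"
  proof (intro set_eqI iffI)
    fix d assume "d \<in> Pi\<^sub>E UNIV B"
    then have d: "d l \<in> B l" for l by auto
    have "d l = c l" if "l < n" for l using d[of l] that by (simp add: B_def)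
    moreover have "d l \<in> digits M" for l
      using d[of l] assms by (auto simp: B_def seqs_def split: if_splits)
    ultimately show "d \<in> {d \<in> seqs M. \<forall>l<n. d l = c l}" by (simp add: seqs_def)
  qed (auto simp: B_def seqs_def)
  ultimately show ?thesis by simp
qed

lemma openin_contains_cylinder:
  assumes "openin (seq_topology M) W" "c \<in> W"
  shows "\<exists>n. {d \<in> seqs M. \<forall>l<n. d l = c l} \<subseteq> W"
proof -
  obtain B where B: "finite {l. B l \<noteq> digits M}" "c \<in> Pi\<^sub>E UNIV B" "Pi\<^sub>E UNIV B \<subseteq> W"
    using assms unfolding seq_topology_def openin_product_topology_alt by auto
  \<comment> \<open>If the set is empty, \<open>Max\<close> is unspecified, but then no index is
    restricted and any \<open>n\<close> works.\<close>
  define n where "n = Suc (Max {l. B l \<noteq> digits M})"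
  have "d \<in> W" if "d \<in> seqs M" "\<forall>l<n. d l = c l" for d
  proof -
    have "d l \<in> B l" for l
    proof (cases "B l = digits M")
      case True
      then show ?thesis using that(1) by (simp add: seqs_def)
    next
      case False
      then have "l < n" using Max_ge[OF B(1), of l] by (simp add: n_def)
      then show ?thesis using that(2) B(2) by auto
    qed
    then have "d \<in> Pi\<^sub>E UNIV B" by auto
    then show ?thesis using B(3) by (rule rev_subsetD)
  qed
  then show ?thesis by auto
qed

text \<open>An occurrence of a forbidden block is visible in finitely many digits, so it persists on
  a whole cylinder.\<close>

lemma closedin_shift_of: "closedin (seq_topology M) (shift_of M F)"
proof -
  have "openin (seq_topology M) (seqs M - shift_of M F)"
  proof (subst openin_subopen, safe)
    fix c assume c: "c \<in> seqs M" "c \<notin> shift_of M F"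
    then obtain i n where n: "n \<ge> 1" "map c [i..<i + n] \<in> F" by (auto simp: shift_of_def)
    let ?T = "{d \<in> seqs M. \<forall>l<i + n. d l = c l}"
    have "d \<notin> shift_of M F" if "d \<in> ?T" for d
    proof -
      have "map d [i..<i + n] = map c [i..<i + n]" using that by auto
      then have "map d [i..<i + n] \<in> F" using n(2) by metis
      then show ?thesis using n(1) unfolding shift_of_def by blast
    qed
    then show "\<exists>T. openin (seq_topology M) T \<and> c \<in> T \<and> T \<subseteq> seqs M - shift_of M F"
      using openin_cylinder[OF c(1)] c(1) by (intro exI[of _ ?T]) auto
  qed
  then show ?thesis
    by (auto simp: closedin_def topspace_seq_topology shift_of_def)
qed

lemma (in quasi_greedy) not_closedin_if_dominant:
  assumes "dominant M (qgreedy q)"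
  shows "\<not> closedin (seq_topology M) (unique_expansions M q)"
proof
  interpret dominant M "qgreedy q" by fact
  \<comment> \<open>The leading 0 is below \<open>M\<close>, so it demands that the next tail be
    strictly below the quasi-greedy expansion; here that tail is this expansion itself.\<close>
  define z where "z = case_nat 0 (qgreedy q)"
  assume "closedin (seq_topology M) (unique_expansions M q)"
  then have "openin (seq_topology M) (seqs M - unique_expansions M q)"
    by (simp add: closedin_def topspace_seq_topology)
  moreover have z: "z \<in> seqs M"
    using digit_le by (auto simp: seqs_iff z_def split: nat.splits)
  moreover have "z \<notin> unique_expansions M q"
  proof
    assume "z \<in> unique_expansions M q"
    then have "lex_less (tail (Suc 0) z) (qgreedy q)"
      using q by (intro unique_expansions_tail_lex) (auto simp: z_def)
    moreover have "tail (Suc 0) z = qgreedy q" by (simp add: z_def tail_def)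
    ultimately show False by simp
  qed
  ultimately obtain n where n: "{d \<in> seqs M. \<forall>l<n. d l = z l} \<subseteq> seqs M - unique_expansions M q"
    using openin_contains_cylinder[of M "seqs M - unique_expansions M q" z] by auto
  obtain m where m: "m > n" "good m" using good_unbounded by blast
  define d where "d = case_nat 0 (alternating m)"
  have t: "tail (Suc j) d = tail j (alternating m)" for j by (simp add: d_def tail_def)
  have ds: "d \<in> seqs M"
    using alternating_in_seqs by (auto simp: seqs_iff d_def split: nat.splits)
  have "d \<in> unique_expansions M q"
    by (rule unique_expansions_qgreedyI[OF ds]) (use alternating_tails_less[of m] m in \<open>auto simp: t\<close>)
  moreover have "d l = z l" if "l < n" for l
    using that m alternating_prefix[of "l - 1" m] by (auto simp: d_def z_def split: nat.splits)
  ultimately show False using n ds by blast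
qed

section \<open>Approximation by univoque bases\<close>

lemma isCont_val:
  assumes q: "1 < q" and c: "c \<in> seqs M"
  shows "isCont (\<lambda>x. val x c) q"
proof -
  \<comment> \<open>\<open>K\<close> is chosen strictly between \<open>1 / q\<close> and 1, so the
    power series in \<open>1 / q\<close> converges at a point beyond \<open>1 / q\<close>.\<close>
  define K where "K = 2 / (1 + q)"
  have K: "1 < 1 / K" "1 / q < K" "0 < K" using q by (auto simp: K_def field_simps)
  have "summable (\<lambda>i. real (c i) * K ^ i)"
  proof -
    have "summable (\<lambda>i. (1 / K) * (real (c i) / (1 / K) ^ (i + 1)))"
      by (intro summable_mult summable_val[OF K(1) c])
    then show ?thesis using K(3) by (simp add: field_simps)
  qed
  then have "isCont (\<lambda>y. \<Sum>i. real (c i) * y ^ i) (1 / q)"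
    by (rule isCont_powser) (use K q in auto)
  moreover have inv: "isCont (\<lambda>x::real. 1 / x) q" using q by (intro continuous_intros) auto
  ultimately have "isCont (\<lambda>x. \<Sum>i. real (c i) * (1 / x) ^ i) q"
    using isCont_o2[of q "\<lambda>x. 1 / x" "\<lambda>y. \<Sum>i. real (c i) * y ^ i"] by blast
  with inv have "isCont (\<lambda>x. (1 / x) * (\<Sum>i. real (c i) * (1 / x) ^ i)) q"
    by (rule isCont_mult)
  moreover have "\<forall>\<^sub>F x in nhds q. val x c = (1 / x) * (\<Sum>i. real (c i) * (1 / x) ^ i)"
  proof -
    have "\<forall>\<^sub>F x in nhds q. 1 < x" using q by (rule order_tendstoD(1)[OF filterlim_ident])
    then show ?thesis
    proof eventually_elim
      case (elim x)
      have "summable (\<lambda>i. x * (real (c i) / x ^ (i + 1)))"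
        by (intro summable_mult summable_val[OF elim c])
      moreover have "x * (real (c i) / x ^ (i + 1)) = real (c i) * (1 / x) ^ i" for i
        using elim by (simp add: power_one_over)
      ultimately have "summable (\<lambda>i. real (c i) * (1 / x) ^ i)" by simp
      then have "(1 / x) * (\<Sum>i. real (c i) * (1 / x) ^ i) = (\<Sum>i. (1 / x) * (real (c i) * (1 / x) ^ i))"
        by (rule suminf_mult[symmetric])
      then show ?case by (simp add: val_def power_one_over)
    qed
  qed
  then have "isCont (\<lambda>x. val x c) q \<longleftrightarrow> isCont (\<lambda>x. (1 / x) * (\<Sum>i. real (c i) * (1 / x) ^ i)) q"
    by (rule isCont_cong)
  ultimately show ?thesis by blast
qed

lemma val_strict_antimono:
  assumes "1 < x" "x < y" "c \<in> seqs M" "c 0 > 0"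
  shows "val y c < val x c"
proof -
  have y: "1 < y" using assms by simp
  have t: "tail 1 c \<in> seqs M" using assms by simp
  have "val y (tail 1 c) \<le> val x (tail 1 c)"
    unfolding val_def
    by (intro suminf_le summable_val[OF _ t] divide_left_mono power_mono) (use assms in auto)
  then have "(real (c 0) + val y (tail 1 c)) / y < (real (c 0) + val x (tail 1 c)) / x"
    using val_nonneg[OF y t] assms by (intro frac_less2) (auto intro: add_pos_nonneg)
  then show ?thesis using val_split assms(1,3) y by metis
qed

lemma val_close_if_prefix_eq:
  assumes "1 < w" "a \<in> seqs M" "\<eta> > 0"
  shows "\<exists>N. \<forall>e\<in>seqs M. (\<forall>i<N. e i = a i) \<longrightarrow> \<bar>val w e - val w a\<bar> < \<eta>"
proof -
  obtain N where N: "(real M / (w - 1)) / \<eta> < w ^ N" using real_arch_pow[OF assms(1)] by blast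
  have "\<bar>val w e - val w a\<bar> < \<eta>" if e: "e \<in> seqs M" "\<forall>i<N. e i = a i" for e
  proof -
    have "\<bar>val w (tail N e) - val w (tail N a)\<bar> \<le> real M / (w - 1)"
      using val_nonneg[of w "tail N e" M] val_nonneg[of w "tail N a" M]
        val_le[of w "tail N e" M] val_le[of w "tail N a" M] assms e(1) by (simp add: abs_le_iff)
    also have "\<dots> < \<eta> * w ^ N" using N assms(3) by (simp only: pos_divide_less_eq mult.commute)
    finally have "\<bar>val w (tail N e) - val w (tail N a)\<bar> / w ^ N < \<eta>"
      using assms(1) by (simp add: pos_divide_less_eq)
    moreover have "val w e - val w a = (val w (tail N e) - val w (tail N a)) / w ^ N"
      using e assms by (intro val_diff) auto
    ultimately show ?thesis using assms(1) by (simp add: abs_divide)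
  qed
  then show ?thesis by blast
qed

text \<open>The value of \<open>a\<close> exceeds 1 slightly below \<open>q\<close> and is less than
  1 slightly above. A long common prefix keeps both inequalities, up to equality, for
  \<open>e\<close>, and the intermediate value theorem gives the base.\<close>

lemma base_close_if_prefix_eq:
  assumes q: "1 < q" and a: "a \<in> seqs M" "val q a = 1" "a 0 > 0" and "\<epsilon> > 0"
  shows "\<exists>N. \<forall>e\<in>seqs M. (\<forall>i<N. e i = a i) \<longrightarrow> (\<exists>p>1. \<bar>p - q\<bar> < \<epsilon> \<and> val p e = 1)"
proof -
  define \<delta> where "\<delta> = min (\<epsilon> / 2) ((q - 1) / 2)"
  define u where "u = q - \<delta>"
  define v where "v = q + \<delta>"
  have \<delta>: "0 < \<delta>" "\<delta> < \<epsilon>" "\<delta> < q - 1" using q \<open>\<epsilon> > 0\<close> by (auto simp: \<delta>_def min_def)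
  then have uv: "1 < u" "u < q" "q < v" "1 < v" using q by (auto simp: u_def v_def)
  have gu: "val u a - 1 > 0" and gv: "1 - val v a > 0"
    using val_strict_antimono[OF uv(1,2) a(1,3)] val_strict_antimono[OF q uv(3) a(1,3)] a(2)
    by auto
  obtain N1 where N1: "\<forall>e\<in>seqs M. (\<forall>i<N1. e i = a i) \<longrightarrow> \<bar>val u e - val u a\<bar> < val u a - 1"
    using val_close_if_prefix_eq[OF uv(1) a(1) gu] by blast
  obtain N2 where N2: "\<forall>e\<in>seqs M. (\<forall>i<N2. e i = a i) \<longrightarrow> \<bar>val v e - val v a\<bar> < 1 - val v a"
    using val_close_if_prefix_eq[OF uv(4) a(1) gv] by blast
  have "\<exists>p>1. \<bar>p - q\<bar> < \<epsilon> \<and> val p e = 1" if e: "e \<in> seqs M" "\<forall>i<max N1 N2. e i = a i" for e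
  proof -
    have "\<bar>val u e - val u a\<bar> < val u a - 1" "\<bar>val v e - val v a\<bar> < 1 - val v a"
      using N1 N2 e by auto
    then have "val v e \<le> 1" "1 \<le> val u e" by linarith+
    moreover have "continuous_on {u..v} (\<lambda>x. val x e)"
      using isCont_val[OF _ e(1)] uv(1) by (intro continuous_at_imp_continuous_on) auto
    ultimately obtain p where p: "u \<le> p" "p \<le> v" "val p e = 1"
      using IVT2'[of "\<lambda>x. val x e" v 1 u] uv by auto
    then have "\<bar>p - q\<bar> \<le> \<delta>" by (auto simp: u_def v_def abs_le_iff)
    then show ?thesis using p uv \<delta> by (intro exI[of _ p]) auto
  qed
  then show ?thesis by blast
qed

lemma univoque_if_strongly_dominant:
  assumes p: "1 < p" and e: "e \<in> seqs M" "val p e = 1" and sd: "strongly_dominant M e"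
  shows "p \<in> univoque_bases M"
proof -
  \<comment> \<open>For \<open>k \<ge> 1\<close>, a zero tail would have the constant reflection
    \<open>M\<close>, which is not below \<open>e\<close>.\<close>
  have pos: "0 < val p (tail k e)" for k
  proof (cases "k = 0")
    case False
    then have "lex_less (mirror M (tail k e)) e" using sd by (simp add: strongly_dominant_def)
    then obtain i where "M - e (k + i) < e i" by (auto simp: lex_less_def mirror_def tail_def)
    moreover have "e i \<le> M" using e(1) by (simp add: seqs_iff)
    ultimately have "tail k e i > 0" by (simp add: tail_def)
    moreover have "tail k e \<in> seqs M" using e(1) by simp
    ultimately show ?thesis
      unfolding val_def using p by (intro suminf_pos2[of _ i] summable_val) auto
  qed (use e in simp)
  have "e \<in> unique_expansions M p"
    by (rule unique_expansions_lexI[OF p e pos e(1)]) (use sd in \<open>auto simp: strongly_dominant_def\<close>)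
  then have "d = e" if "is_expansion M p d 1" for d
    using unique_expansions_eqI[OF p, of e M d] that e(2) is_expansion_iff_val[OF p] by simp
  moreover have "is_expansion M p e 1" using e is_expansion_iff_val[OF p] by simp
  ultimately have "\<exists>!c. is_expansion M p c 1" by blast
  then show ?thesis using p by (simp add: univoque_bases_def)
qed

lemma (in quasi_greedy) closure_if_dominant:
  assumes "dominant M (qgreedy q)"
  shows "q \<in> closure (univoque_bases M)"
  unfolding closure_approachable
proof (intro allI impI)
  fix \<epsilon> :: real assume "\<epsilon> > 0"
  then obtain N where N: "\<forall>e\<in>seqs M. (\<forall>i<N. e i = qgreedy q i) \<longrightarrow> (\<exists>p>1. \<bar>p - q\<bar> < \<epsilon> \<and> val p e = 1)"
    using base_close_if_prefix_eq[OF q(1) qgreedy_seqs val_qgreedy qgreedy_first_pos[OF q(1)]] by blast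
  obtain e where e: "e \<in> seqs M" "\<forall>i<N. e i = qgreedy q i" "strongly_dominant M e"
    using dominant.strongly_dominant_approx[OF assms] by blast
  then obtain p where "1 < p" "\<bar>p - q\<bar> < \<epsilon>" "val p e = 1" using N by blast
  then show "\<exists>p\<in>univoque_bases M. dist p q < \<epsilon>"
    using univoque_if_strongly_dominant e by (auto simp: dist_real_def)
qed

section \<open>Limits of univoque bases\<close>

lemma univoque_basesD:
  assumes "p \<in> univoque_bases M"
  shows "quasi_greedy M p" "qgreedy p \<in> unique_expansions M p"
proof -
  have p: "1 < p" and ex: "\<exists>!c. is_expansion M p c 1"
    using assms by (auto simp: univoque_bases_def)
  obtain c where c: "c \<in> seqs M" "val p c = 1" using ex is_expansion_iff_val[OF p] by auto
  \<comment> \<open>That 1 has an expansion bounds the base by \<open>M + 1\<close>.\<close>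
  then have "1 \<le> real M / (p - 1)" using val_le[OF p c(1)] by simp
  then show qg: "quasi_greedy M p" using p by unfold_locales (auto simp: field_simps)
  interpret quasi_greedy M p by fact
  have "is_expansion M p (qgreedy p) 1"
    using val_qgreedy qgreedy_seqs is_expansion_iff_val[OF p] by simp
  then show "qgreedy p \<in> unique_expansions M p"
    using ex \<open>1 \<le> real M / (p - 1)\<close> by (auto simp: unique_expansions_def J_def intro!: bexI[of _ 1])
qed

lemma univoque_mirror_tail_less:
  assumes "p \<in> univoque_bases M" "j \<ge> 1"
  shows "val p (mirror M (tail j (qgreedy p))) < 1"
proof -
  interpret quasi_greedy M p using univoque_basesD[OF assms(1)] by simp
  show ?thesis
    using unique_expansions_mirror_tail_less'[OF q univoque_basesD(2)[OF assms(1)]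
        qgreedy_first_pos[OF q(1)], of j] assms(2) by simp
qed

context quasi_greedy
begin

text \<open>As long as the digits agree, the remainders are the same polynomial in the base. For univoque
  bases near \<open>q < M + 1\<close> the remainders stay away from 0, which pins down the next digit.\<close>

lemma qgreedy_eventually_prefix_eq:
  assumes "q < real M + 1"
  shows "\<forall>\<^sub>F p in nhds q. p \<in> univoque_bases M \<longrightarrow> (\<forall>i<N. qgreedy p i = qgreedy q i)"
proof (induction N)
  case (Suc N)
  \<comment> \<open>\<open>h n\<close> is the polynomial giving the \<open>n\<close>-th remainder
    when the digits of base \<open>q\<close> are used in a variable base.\<close>
  define h where "h = (\<lambda>n p. rec_nat 1 (\<lambda>n y. p * y - real (qgreedy q n)) n)"
  have h0: "h 0 p = 1" and hS: "h (Suc n) p = p * h n p - real (qgreedy q n)" for n p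
    by (simp_all add: h_def)
  have cont: "isCont (h n) x" for n x
  proof (induction n)
    case 0
    then show ?case by (simp add: h_def)
  next
    case (Suc n)
    have "h (Suc n) = (\<lambda>p. p * h n p - real (qgreedy q n))" using hS by blast
    then show ?case using Suc by (auto intro!: continuous_intros)
  qed
  have hrem: "h n p = qrem p n" if "1 < p" "\<forall>i<n. qgreedy p i = qgreedy q i" for n p
    using that(2)
  proof (induction n)
    case (Suc n)
    then show ?case using hS qrem_Suc[OF that(1), of n] by simp
  qed (simp add: h0)
  define R where "R = qrem q (Suc N)"
  \<comment> \<open>Half the gap between the largest value and 1. In a univoque base near
    \<open>q\<close>, the bound on reflected tails keeps the remainders above this number.\<close>
  define \<delta> where "\<delta> = (real M / (q - 1) - 1) / 2"
  have R: "0 < R" "R \<le> 1" using qrem_bounds[of q "Suc N"] unfolding R_def by blast+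
  have \<delta>: "0 < \<delta>" using assms q by (simp add: \<delta>_def field_simps)
  \<comment> \<open>The bound by \<open>\<delta>\<close> prevents the next digit in base
    \<open>p\<close> from being too large, the bound by \<open>R\<close> from being too
    small.\<close>
  define \<eta> where "\<eta> = min R \<delta>"
  have \<eta>: "0 < \<eta>" "\<eta> \<le> R" "\<eta> \<le> \<delta>" using R \<delta> by (auto simp: \<eta>_def)
  have "(h (Suc N) \<longlongrightarrow> h (Suc N) q) (nhds q)"
    using cont[of q "Suc N"] by (simp only: isCont_def tendsto_at_iff_tendsto_nhds)
  moreover have "h (Suc N) q = R" using hrem[OF q(1), of "Suc N"] by (simp only: R_def simp_thms)
  ultimately have "(h (Suc N) \<longlongrightarrow> R) (nhds q)" by simp
  then have "\<forall>\<^sub>F p in nhds q. dist (h (Suc N) p) R < \<eta>" using \<eta>(1) by (rule tendstoD)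
  moreover have "\<forall>\<^sub>F p in nhds q. \<delta> < real M / (p - 1) - 1"
  proof -
    have "isCont (\<lambda>p. real M / (p - 1) - 1) q" using q by (intro continuous_intros) auto
    then have "((\<lambda>p. real M / (p - 1) - 1) \<longlongrightarrow> real M / (q - 1) - 1) (nhds q)"
      unfolding isCont_def
      by (rule tendsto_at_iff_tendsto_nhds[of "\<lambda>p. real M / (p - 1) - 1", THEN iffD1])
    moreover have "\<delta> < real M / (q - 1) - 1"
    proof -
      have "real M / (q - 1) - 1 = 2 * \<delta>" unfolding \<delta>_def by simp
      then show ?thesis using \<delta> by (simp only:)
    qed
    ultimately show ?thesis by (rule order_tendstoD(1))
  qed
  ultimately show ?case using Suc
  proof eventually_elim
    case (elim p)
    show ?case
    proof
      assume U: "p \<in> univoque_bases M"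
      interpret P: quasi_greedy M p using univoque_basesD[OF U] by simp
      have eq: "\<forall>i<N. qgreedy p i = qgreedy q i" using elim U by simp
      have "qrem p (Suc N) = h (Suc N) p + real (qgreedy q N) - real (qgreedy p N)"
        using hrem[OF P.q(1) eq] qrem_Suc[OF P.q(1), of N] by (simp add: hS)
      moreover have "qrem p (Suc N) > real M / (p - 1) - 1"
        using univoque_mirror_tail_less[OF U, of "Suc N"] val_mirror[of p "tail (Suc N) (qgreedy p)" M]
          P.q P.qgreedy_seqs P.val_tail_qgreedy[of "Suc N"] by simp
      moreover have "qrem p (Suc N) \<le> 1" using qrem_bounds by blast
      moreover have "R - \<eta> < h (Suc N) p" "h (Suc N) p < R + \<eta>"
        using elim(1) by (auto simp: dist_real_def abs_less_iff)
      ultimately have "real (qgreedy p N) - real (qgreedy q N) < 1"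
        "real (qgreedy q N) - real (qgreedy p N) < 1"
        using elim(2) R \<eta> by linarith+
      then have "qgreedy p N = qgreedy q N" by linarith
      then show "\<forall>i<Suc N. qgreedy p i = qgreedy q i" using eq less_Suc_eq by auto
    qed
  qed
qed simp

lemma qgreedy_top_base:
  assumes "q = real M + 1"
  shows "qgreedy q n = M"
proof -
  have r: "qrem q n = 1" for n using assms by (induction n) auto
  show "qgreedy q n = M" using assms unfolding qgreedy_def r by simp
qed

lemma dominant_if_closure:
  assumes "q \<in> closure (univoque_bases M)"
  shows "dominant M (qgreedy q)"
  unfolding dominant_qgreedy_iff
proof (intro allI impI)
  fix k :: nat assume k: "k \<ge> 1"
  define a where "a = qgreedy q"
  have a: "a \<in> seqs M" using qgreedy_seqs by (simp add: a_def)
  show "lex_less (mirror M (tail k (qgreedy q))) (qgreedy q)"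
  proof (cases "q = real M + 1")
    case True
    then show ?thesis
      using qgreedy_top_base[OF True] q by (intro lex_lessI[of 0]) (auto simp: mirror_def tail_def)
  next
    case False
    then have qM: "q < real M + 1" using q by simp
    show ?thesis unfolding a_def[symmetric]
    proof (rule ccontr)
      assume nl: "\<not> lex_less (mirror M (tail k a)) a"
      obtain n where n: "mirror M (tail k a) = a \<or> lex_less_upto n a (mirror M (tail k a))"
        using nl lex_less_linear lex_less_iff_upto by metis
      \<comment> \<open>A strict failure is visible in \<open>n + k\<close> digits; in the case of
        equality \<open>a\<close> has period \<open>k + k\<close>, and a whole period must
        agree.\<close>
      obtain p where p: "p \<in> univoque_bases M" "\<forall>i<n + k + k. qgreedy p i = a i"
      proof -
        obtain \<epsilon> where "\<epsilon> > 0" and \<epsilon>: "\<And>p. dist p q < \<epsilon> \<Longrightarrow> p \<in> univoque_bases M \<Longrightarrow>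
            \<forall>i<n + k + k. qgreedy p i = a i"
          using qgreedy_eventually_prefix_eq[OF qM, of "n + k + k"]
          unfolding eventually_nhds_metric a_def by blast
        then obtain p where "p \<in> univoque_bases M" "dist p q < \<epsilon>"
          using assms by (meson closure_approachable)
        then show ?thesis using \<epsilon> that by blast
      qed
      interpret P: quasi_greedy M p using univoque_basesD[OF p(1)] by simp
      define g where "g = qgreedy p"
      have g: "g \<in> seqs M" using P.qgreedy_seqs by (simp add: g_def)
      have ga: "g i = a i" if "i < n + k + k" for i using p(2) that by (simp add: g_def)
      have mg: "lex_less (mirror M (tail k g)) g"
        using univoque_mirror_tail_less[OF p(1) k] P.lex_less_qgreedy by (simp add: g_def)
      show False
        using n
      proof
        assume "lex_less_upto n a (mirror M (tail k a))"
        then have "lex_less_upto n g (mirror M (tail k g))"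
          by (rule lex_less_upto_cong) (auto simp: ga mirror_def tail_def)
        then show False using mg lex_less_asym lex_less_iff_upto by blast
      next
        assume refl: "mirror M (tail k a) = a"
        then have ka: "tail k a = mirror M a" using a by (metis mirror_mirror tail_in_seqs)
        consider "g = a" | "lex_less g a" | "lex_less a g" using lex_less_linear by blast
        then show False
        proof cases
          case 1
          then show False using mg refl by simp
        next
          case 2
          \<comment> \<open>This closes a cycle: \<open>tail k g\<close> is below
            \<open>mirror M a\<close>, which is below \<open>mirror M g\<close>, which is below
            \<open>tail k g\<close>.\<close>
          then have "lex_less (tail k g) (mirror M a)"
            using lex_less_tail[of k g a] ga by (simp add: ka)
          moreover have "lex_less (mirror M a) (mirror M g)"
            using 2 lex_less_mirror a g by blast
          moreover have "lex_less (mirror M g) (tail k g)"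
            using mg lex_less_mirror_left g by simp
          ultimately show False using lex_less_trans lex_less_irrefl by blast
        next
          case 3
          then obtain i where i: "\<forall>l<i. a l = g l" "a i < g i" by (auto simp: lex_less_def)
          \<comment> \<open>As \<open>g\<close> first exceeds the periodic \<open>a\<close> at
            \<open>i\<close>, its tail at \<open>k + k\<close> first exceeds \<open>g\<close> one
            period earlier, contradicting maximality of \<open>g\<close> among its tails.\<close>
          then have ik: "k + k \<le> i" using ga by (metis less_irrefl not_le trans_less_add2 add.assoc)
          have "tail (k + k) a = a"
            using tail_tail[of k k a] by (simp add: ka tail_mirror a)
          then have per: "a (k + k + l) = a l" for l by (metis tail_def)
          have "lex_less g (tail (k + k) g)"
          proof (rule lex_lessI[of "i - (k + k)"])
            show "g l = tail (k + k) g l" if "l < i - (k + k)" for l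
              using i(1)[rule_format, of l] i(1)[rule_format, of "k + k + l"] per[of l] that
              by (simp add: tail_def)
            show "g (i - (k + k)) < tail (k + k) g (i - (k + k))"
              using i(1)[rule_format, of "i - (k + k)"] i(2) per[of "i - (k + k)"] ik k
              by (simp add: tail_def)
          qed
          then show False using P.qgreedy_tail_le by (simp add: g_def)
        qed
      qed
    qed
  qed
qed

end

theorem theorem1p12:
  fixes M :: nat and q :: real
  assumes "M \<ge> 1" and "1 < q" and "q \<le> real M + 1"
  shows "(q \<notin> closure (univoque_bases M) \<longleftrightarrow> is_shift_of_finite_type M (unique_expansions M q)) \<and>
         (is_shift_of_finite_type M (unique_expansions M q) \<longleftrightarrow> is_shift M (unique_expansions M q)) \<and>
         (is_shift M (unique_expansions M q) \<longleftrightarrow> closedin (seq_topology M) (unique_expansions M q))"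
proof -
  interpret quasi_greedy M q using assms by unfold_locales
  have "q \<notin> closure (univoque_bases M) \<Longrightarrow> is_shift_of_finite_type M (unique_expansions M q)"
    using finite_type_if_not_dominant closure_if_dominant by blast
  moreover have "is_shift_of_finite_type M (unique_expansions M q) \<Longrightarrow> is_shift M (unique_expansions M q)"
    by (auto simp: is_shift_of_finite_type_def is_shift_def)
  moreover have "is_shift M (unique_expansions M q) \<Longrightarrow> closedin (seq_topology M) (unique_expansions M q)"
    using closedin_shift_of by (auto simp: is_shift_def)
  moreover have "closedin (seq_topology M) (unique_expansions M q) \<Longrightarrow> q \<notin> closure (univoque_bases M)"
    using not_closedin_if_dominant dominant_if_closure by blast
  ultimately show ?thesis by blast
qed

end
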